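(* For all integers $n\ge 0$ and $\alpha\ge 1$, every prime $p\ge 5$, and every $j\in\{1,2,\ldots,p-1\}$, $$b\left(p^{2\alpha}n+\frac{(3j+p)p^{2\alpha-1}-1}{3}\right)\equiv 0\pmod 2.$$
   Context: For a positive integer $k$, $(q^k;q^k)_\infty:=\prod_{m\ge 1}(1-q^{km})$, viewed as a formal power series in $q$ with integer coefficients. The integers $b(n)$ ($n\ge 0$) are defined by the generating function $$\sum_{n=0}^\infty b(n)q^n=\frac{(q^4;q^4)_\infty^3}{(q^2;q^2)_\infty^2}.$$ *)

theory Defs
  imports "HOL-Analysis.Analysis" "HOL-Number_Theory.Number_Theory"
begin

text \<open>
  The product \<open>(q^k; q^k)\<^sub>\<infinity> = (1 - q^k) (1 - q^(2k)) (1 - q^(3k)) \<cdots>\<close> in the ring of formal power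
  series over the integers, taken in the library's topology on \<^typ>\<open>int fps\<close>, in which a sequence
  converges iff each of its coefficients is eventually constant. The binder starts at \<open>0\<close>, so the
  factor number \<open>m \<ge> 1\<close> is the one with index \<open>m - 1\<close>.
\<close>

definition euler_fps :: "nat \<Rightarrow> int fps" where
  "euler_fps k = (\<Prod>m. 1 - fps_X ^ (k * Suc m))"

lemma has_prod_euler_fps:
  assumes "k > 0"
  shows "(\<lambda>m. 1 - fps_X ^ (k * Suc m)) has_prod euler_fps k"
    and fps_nth_0_euler_fps: "fps_nth (euler_fps k) 0 = 1"
proof -
  define f :: "nat \<Rightarrow> int fps" where "f = (\<lambda>m. 1 - fps_X ^ (k * Suc m))"
  define P where "P = (\<lambda>N. \<Prod>m\<le>N. f m)"
  define L where "L = Abs_fps (\<lambda>n. fps_nth (P n) n)"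
  have step: "fps_nth (P (Suc N)) n = fps_nth (P N) n" if "n \<le> N" for n N
  proof -
    have "n < k * Suc (Suc N)"
      using assms that by (metis less_Suc_eq_le less_SucI mult_1 mult_le_mono1 order_less_le_trans
        One_nat_def Suc_leI)
    then have "fps_nth (P N * fps_X ^ (k * Suc (Suc N))) n = 0"
      by (simp only: fps_X_power_mult_right_nth if_True)
    then show ?thesis
      unfolding P_def by (simp add: f_def right_diff_distrib)
  qed
  have const: "fps_nth (P N) n = fps_nth L n" if "n \<le> N" for n N
    using that by (induction rule: dec_induct) (auto simp: L_def step)
  have "P \<longlonglongrightarrow> L"
    by (rule tendsto_fpsI) (auto simp: eventually_at_top_linorder intro: const)
  moreover have L0: "fps_nth L 0 = 1"
    using assms by (simp add: L_def P_def f_def)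
  then have "L \<noteq> 0" by auto
  ultimately have "f has_prod L"
    by (simp add: has_prod_def raw_has_prod_def P_def)
  moreover from this have "euler_fps k = L"
    using has_prod_unique[of f L] by (simp add: euler_fps_def f_def)
  ultimately show "(\<lambda>m. 1 - fps_X ^ (k * Suc m)) has_prod euler_fps k"
    and "fps_nth (euler_fps k) 0 = 1"
    using L0 by (simp_all add: f_def)
qed

text \<open>
  Division in \<^typ>\<open>int fps\<close> is unavailable (\<^typ>\<open>int\<close> has no \<^const>\<open>inverse\<close>), so the quotient
  is written with the reciprocal \<open>fps_right_inverse f 1\<close> of a series \<open>f\<close> with constant term \<open>1\<close>.
\<close>

definition b :: "nat \<Rightarrow> int" where
  "b n = fps_nth (euler_fps 4 ^ 3 * fps_right_inverse (euler_fps 2 ^ 2) 1) n"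

lemma b_gen_fun: "Abs_fps b * euler_fps 2 ^ 2 = euler_fps 4 ^ 3"
proof -
  have "Abs_fps b = euler_fps 4 ^ 3 * fps_right_inverse (euler_fps 2 ^ 2) 1"
    by (simp add: fps_eq_iff b_def)
  moreover have "euler_fps 2 ^ 2 * fps_right_inverse (euler_fps 2 ^ 2) 1 = 1"
    by (rule fps_right_inverse) (simp add: fps_nth_0_euler_fps fps_nth_power_0)
  ultimately show ?thesis by (simp add: mult_ac)
qed

text \<open>The natural-number subtraction and division in the argument of \<open>b\<close> are exact.\<close>

lemma index_exact:
  fixes p j \<alpha> :: nat
  assumes "prime p" "p \<ge> 5" "\<alpha> \<ge> 1"
  shows "3 * (((3 * j + p) * p ^ (2 * \<alpha> - 1) - 1) div 3) + 1 = (3 * j + p) * p ^ (2 * \<alpha> - 1)"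
proof -
  have "\<not> 3 dvd p"
    using assms primes_dvd_imp_eq[of 3 p] by auto
  then have "p mod 3 = 1 \<or> p mod 3 = 2" by presburger
  then have "p ^ 2 mod 3 = 1"
    by (subst power_mod[symmetric]) auto
  then have "p ^ (2 * \<alpha>) mod 3 = 1"
    using power_mod[of "p ^ 2" 3 \<alpha>] by (simp add: power_mult)
  moreover have "p * p ^ (2 * \<alpha> - 1) = p ^ (2 * \<alpha>)"
    using assms by (simp add: power_eq_if)
  then have "(3 * j + p) * p ^ (2 * \<alpha> - 1) = 3 * (j * p ^ (2 * \<alpha> - 1)) + p ^ (2 * \<alpha>)"
    by (simp add: algebra_simps)
  ultimately have "((3 * j + p) * p ^ (2 * \<alpha> - 1)) mod 3 = 1" by presburger
  then show ?thesis by presburger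
qed

end

theory Submission
  imports Defs "HOL-Library.Nat_Bijection"
begin

text \<open>
  Write \<open>f\<^sub>k = (q^k; q^k)\<^sub>\<infinity>\<close>. Since \<open>(1 - x)^2\<close> and \<open>1 - x^2\<close> agree modulo \<open>2\<close>, so do \<open>f\<^sub>k^2\<close>
  and \<open>f\<^bsub>2k\<^esub>\<close> (lemma \<open>euler_fps_square_mod_2\<close>), and the generating function of \<open>b\<close> collapses to
  a single product: \<open>f\<^sub>4^3 / f\<^sub>2^2 \<equiv> f\<^sub>4^2 \<equiv> f\<^sub>8\<close>. By Euler's pentagonal number theorem,
  \<open>f\<^sub>8\<close> is supported on the exponents \<open>m = 4 s (3 s \<plusminus> 1)\<close>, for which \<open>3 m + 1 = (6 s \<plusminus> 1)^2\<close>.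
  Hence \<open>b m\<close> is even unless \<open>3 m + 1\<close> is a perfect square (lemma \<open>odd_b_imp_square\<close>).
  For the index \<open>m\<close> of the theorem,
  \<open>3 m + 1 = p^(2 \<alpha> - 1) * (3 p n + 3 j + p)\<close>,
  and \<open>p\<close> does not divide the second factor, because it divides neither \<open>3\<close> nor \<open>j\<close>. So \<open>p\<close> occurs
  in \<open>3 m + 1\<close> to an odd power, and \<open>3 m + 1\<close> is not a square.

  The pentagonal number theorem is reached through Shanks's finite identity (lemma
  \<open>pentagonal_finite\<close>), which holds for every element \<open>q\<close> of a commutative ring and whose left-hand
  side agrees with \<open>(1 - q) \<cdots> (1 - q^N)\<close> up to terms divisible by \<open>q^N\<close>.
\<close>

section \<open>The pentagonal number theorem\<close>

text \<open>
  The exponents \<open>s^2 + triangle s\<close> and \<open>s^2 + triangle (s - 1)\<close> on the right are the generalized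
  pentagonal numbers \<open>s (3 s \<plusminus> 1) / 2\<close>. On passing from \<open>n\<close> to \<open>n + 1\<close>, the terms \<open>s \<le> n\<close> on the
  left change by \<open>g (s - 1) - g s\<close>, where \<open>g\<close> is defined in the proof; so the change telescopes, and
  together with the new term \<open>s = n + 1\<close> it contributes exactly two signed powers of \<open>q\<close>.
\<close>

lemma pentagonal_finite:
  fixes q :: "'a :: comm_ring_1"
  shows "(\<Sum>s\<le>n. (- 1) ^ s * q ^ (s * n + triangle s) * (\<Prod>i\<in>{s<..n}. 1 - q ^ i)) =
    1 + (\<Sum>s=1..n. (- 1) ^ s * (q ^ (s\<^sup>2 + triangle (s - 1)) + q ^ (s\<^sup>2 + triangle s)))"
proof (induction n)
  case 0
  show ?case by simp
next
  case (Suc n)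
  define t where "t = (\<lambda>n s. (- 1) ^ s * q ^ (s * n + triangle s) * (\<Prod>i\<in>{s<..n}. 1 - q ^ i))"
  define g where
    "g = (\<lambda>s. (- 1) ^ s * q ^ (Suc s * Suc n + triangle s) * (\<Prod>i\<in>{s<..n}. 1 - q ^ i))"
  have top: "(\<Prod>i\<in>{s<..Suc n}. 1 - q ^ i) = (1 - q ^ Suc n) * (\<Prod>i\<in>{s<..n}. 1 - q ^ i)"
    if "s \<le> n" for s
  proof -
    have "{s<..Suc n} = insert (Suc n) {s<..n}"
      using that by auto
    then show ?thesis by simp
  qed
  have bot: "(\<Prod>i\<in>{s<..n}. 1 - q ^ i) = (1 - q ^ Suc s) * (\<Prod>i\<in>{Suc s<..n}. 1 - q ^ i)"
    if "Suc s \<le> n" for s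
  proof -
    have "{s<..n} = insert (Suc s) {Suc s<..n}"
      using that by auto
    then show ?thesis by simp
  qed
  have zero: "t (Suc n) 0 - t n 0 = - g 0"
    unfolding t_def g_def by (simp add: top algebra_simps)
  \<comment> \<open>This is \<open>(1 - q^(n+1)) q^s - 1 = - (1 - q^s) - q^(n+1+s)\<close>; the factor \<open>1 - q^s\<close> extends the
    product in \<open>t n s\<close> downwards to the one in \<open>g (s - 1)\<close>.\<close>
  have step: "t (Suc n) (Suc s) - t n (Suc s) = g s - g (Suc s)" if "Suc s \<le> n" for s
    unfolding t_def g_def top[OF that] bot[OF that]
    by (simp add: algebra_simps power_add)
  have tele: "(\<Sum>s\<le>m. t (Suc n) s - t n s) = - g m" if "m \<le> n" for m
    using that by (induction m) (simp_all add: zero step)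
  have "(\<Sum>s\<le>n. t (Suc n) s) = (\<Sum>s\<le>n. t n s) - g n"
    using tele[of n] by (simp add: sum_subtractf algebra_simps)
  moreover have "g n = (- 1) ^ n * q ^ ((Suc n)\<^sup>2 + triangle n)"
    unfolding g_def by (simp add: power2_eq_square)
  moreover have "t (Suc n) (Suc n) = (- 1) ^ Suc n * q ^ ((Suc n)\<^sup>2 + triangle (Suc n))"
    unfolding t_def by (simp add: power2_eq_square)
  moreover have "(\<Sum>s\<le>n. t n s) =
    1 + (\<Sum>s=1..n. (- 1) ^ s * (q ^ (s\<^sup>2 + triangle (s - 1)) + q ^ (s\<^sup>2 + triangle s)))"
    using Suc.IH unfolding t_def .
  ultimately have "(\<Sum>s\<le>Suc n. t (Suc n) s) =
    1 + (\<Sum>s=1..Suc n. (- 1) ^ s * (q ^ (s\<^sup>2 + triangle (s - 1)) + q ^ (s\<^sup>2 + triangle s)))"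
    by (simp add: distrib_left del: triangle_Suc)
  then show ?case unfolding t_def .
qed

lemma euler_fps_nth:
  assumes "k > 0" and "n \<le> N"
  shows "fps_nth (euler_fps k) n = fps_nth (\<Prod>i\<in>{0<..N}. 1 - (fps_X ^ k) ^ i) n"
proof -
  define P :: "nat \<Rightarrow> int fps" where "P = (\<lambda>N. \<Prod>i\<in>{0<..N}. 1 - (fps_X ^ k) ^ i)"
  have P_eq: "P (Suc N) = (\<Prod>m\<le>N. 1 - fps_X ^ (k * Suc m))" for N
  proof -
    have "{0<..Suc N} = Suc ` {..N}"
      by (auto simp: image_iff gr0_conv_Suc)
    then show ?thesis
      unfolding P_def by (simp add: prod.reindex power_mult del: power_Suc mult_Suc_right)
  qed
  have stable: "fps_nth (P (Suc M)) n = fps_nth (P M) n" if "n \<le> M" for M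
  proof -
    have "{0<..Suc M} = insert (Suc M) {0<..M}" by auto
    then have "P (Suc M) = (1 - (fps_X ^ k) ^ Suc M) * P M"
      unfolding P_def by (simp del: power_Suc)
    also have "\<dots> = P M - P M * fps_X ^ (k * Suc M)"
      by (simp only: power_mult mult.commute[of _ "P M"] right_diff_distrib mult_1_right)
    finally have "P (Suc M) = P M - P M * fps_X ^ (k * Suc M)" .
    moreover have "n < k * Suc M"
      using assms(1) that by (cases k) auto
    ultimately show ?thesis
      by (simp only: fps_sub_nth fps_X_power_mult_right_nth if_True diff_0_right)
  qed
  have const: "fps_nth (P M) n = fps_nth (P N) n" if "N \<le> M" for M
    using that
  proof (induction M rule: dec_induct)
    case (step M)
    then show ?case using assms(2) by (simp add: stable)
  qed simp
  have "(\<lambda>M. P (Suc M)) \<longlonglongrightarrow> euler_fps k"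
    unfolding P_eq using has_prod_euler_fps(1)[OF assms(1)] by (rule has_prod_imp_tendsto)
  then have "\<forall>\<^sub>F M in sequentially. fps_nth (P (Suc M)) n = fps_nth (euler_fps k) n"
    by (simp add: tendsto_fps_iff)
  then obtain M where "\<And>M'. M' \<ge> M \<Longrightarrow> fps_nth (P (Suc M')) n = fps_nth (euler_fps k) n"
    by (auto simp: eventually_sequentially)
  then have "fps_nth (P (Suc (M + N))) n = fps_nth (euler_fps k) n" by simp
  then show ?thesis
    using const[of "Suc (M + N)"] unfolding P_def by simp
qed

text \<open>
  In \<open>pentagonal_finite\<close> at \<open>q = X^k\<close>, the term \<open>s = 0\<close> on the left is the truncated product, and all
  other terms are divisible by \<open>X^(k N)\<close>. So a nonzero coefficient of \<open>f\<^sub>k\<close> sits at \<open>k\<close> times a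
  generalized pentagonal number \<open>e\<close>, and those satisfy \<open>24 e + 1 = (6 s \<plusminus> 1)^2\<close>.
\<close>

lemma euler_fps_support:
  assumes "k > 0" and "fps_nth (euler_fps k) m \<noteq> 0"
  shows "\<exists>r. 24 * m + k = k * r\<^sup>2"
proof -
  define N where "N = Suc m"
  define q :: "int fps" where "q = fps_X ^ k"
  have q_nth: "fps_nth ((- 1) ^ s * q ^ e) m = (if m = k * e then (- 1) ^ s else 0)" for s e
  proof -
    have "q ^ e = fps_X ^ (k * e)" by (simp add: q_def power_mult)
    then show ?thesis
      by (cases "even s") auto
  qed
  have tail: "fps_nth ((- 1) ^ s * q ^ (s * N + triangle s) * F) m = 0" if "s > 0" for s F
  proof -
    have "m < k * (s * N + triangle s)"
      using that assms(1) by (cases k; cases s) (auto simp: N_def)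
    moreover have "(- 1) ^ s * q ^ (s * N + triangle s) * F =
      ((- 1) ^ s * F) * fps_X ^ (k * (s * N + triangle s))"
      by (simp only: q_def power_mult mult_ac)
    ultimately show ?thesis
      by (simp only: fps_X_power_mult_right_nth if_True)
  qed
  have "fps_nth (\<Sum>s\<le>N. (- 1) ^ s * q ^ (s * N + triangle s) * (\<Prod>i\<in>{s<..N}. 1 - q ^ i)) m =
    fps_nth (\<Prod>i\<in>{0<..N}. 1 - q ^ i) m"
  proof -
    have "(\<Sum>s\<in>{..N} - {0}.
        fps_nth ((- 1) ^ s * q ^ (s * N + triangle s) * (\<Prod>i\<in>{s<..N}. 1 - q ^ i)) m) = 0"
      by (rule sum.neutral) (use tail in simp)
    then show ?thesis
      by (simp add: fps_sum_nth sum.remove[of "{..N}" 0])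
  qed
  also have "\<dots> = fps_nth (euler_fps k) m"
    unfolding q_def using euler_fps_nth[OF assms(1), of m N] by (simp add: N_def)
  finally have "fps_nth (1 + (\<Sum>s=1..N. (- 1) ^ s *
      (q ^ (s\<^sup>2 + triangle (s - 1)) + q ^ (s\<^sup>2 + triangle s)))) m \<noteq> 0"
    using assms(2) by (simp only: pentagonal_finite) simp
  then have "m = 0 \<or> (\<exists>s\<ge>1. m = k * (s\<^sup>2 + triangle (s - 1)) \<or> m = k * (s\<^sup>2 + triangle s))"
  proof (rule contrapos_np)
    assume *: "\<not> ?thesis"
    have "fps_nth ((- 1) ^ s * (q ^ (s\<^sup>2 + triangle (s - 1)) + q ^ (s\<^sup>2 + triangle s))) m = 0"
      if "s \<in> {1..N}" for s
      using * that by (simp only: distrib_left fps_add_nth q_nth) auto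
    then show "fps_nth (1 + (\<Sum>s=1..N. (- 1) ^ s *
      (q ^ (s\<^sup>2 + triangle (s - 1)) + q ^ (s\<^sup>2 + triangle s)))) m = 0"
      using * by (simp add: fps_sum_nth)
  qed
  then consider "m = 0" | s where "m = k * ((Suc s)\<^sup>2 + triangle s)"
    | s where "m = k * (s\<^sup>2 + triangle s)"
    by (metis One_nat_def Suc_le_D diff_Suc_1)
  then show ?thesis
  proof cases
    case 1
    then show ?thesis by (intro exI[of _ 1]) simp
  next
    case (2 s)
    have "2 * triangle s = s * Suc s" by (simp add: triangle_def)
    then have "24 * ((Suc s)\<^sup>2 + triangle s) + 1 = (6 * s + 5)\<^sup>2"
      by (simp add: power2_eq_square algebra_simps)
    then have "k * (24 * ((Suc s)\<^sup>2 + triangle s) + 1) = k * (6 * s + 5)\<^sup>2" by simp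
    then show ?thesis
      using 2 by (intro exI[of _ "6 * s + 5"]) (simp add: algebra_simps)
  next
    case (3 s)
    have "2 * triangle s = s * Suc s" by (simp add: triangle_def)
    then have "24 * (s\<^sup>2 + triangle s) + 1 = (6 * s + 1)\<^sup>2"
      by (simp add: power2_eq_square algebra_simps)
    then have "k * (24 * (s\<^sup>2 + triangle s) + 1) = k * (6 * s + 1)\<^sup>2" by simp
    then show ?thesis
      using 3 by (intro exI[of _ "6 * s + 1"]) (simp add: algebra_simps)
  qed
qed

section \<open>Reduction modulo 2\<close>

lemma two_dvd_fps_iff: "(2 :: int fps) dvd F \<longleftrightarrow> (\<forall>n. even (fps_nth F n))"
proof
  assume "2 dvd F"
  then obtain G where "F = 2 * G" by (rule dvdE)
  then have "fps_nth F n = 2 * fps_nth G n" for n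
    by (simp add: fps_numeral_fps_const)
  then show "\<forall>n. even (fps_nth F n)" by simp
next
  assume *: "\<forall>n. even (fps_nth F n)"
  have "F = 2 * Abs_fps (\<lambda>n. fps_nth F n div 2)"
    by (rule fps_ext) (use * in \<open>simp add: fps_numeral_fps_const\<close>)
  then show "2 dvd F" by (rule dvdI)
qed

lemma prod_square_mod_2:
  fixes x :: "'i \<Rightarrow> 'a :: comm_ring_1"
  assumes "finite I"
  shows "2 dvd (\<Prod>i\<in>I. 1 - x i)\<^sup>2 - (\<Prod>i\<in>I. 1 - (x i)\<^sup>2)"
  using assms
proof induction
  case (insert i I)
  define A where "A = (\<Prod>i\<in>I. 1 - x i)\<^sup>2"
  define B where "B = (\<Prod>i\<in>I. 1 - (x i)\<^sup>2)"
  have "(1 - x i)\<^sup>2 * A - (1 - (x i)\<^sup>2) * B =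
    (1 - x i)\<^sup>2 * (A - B) + 2 * (((x i)\<^sup>2 - x i) * B)"
    by (simp add: power2_eq_square algebra_simps)
  moreover have "2 dvd A - B"
    using insert.IH by (simp add: A_def B_def)
  ultimately have "2 dvd (1 - x i)\<^sup>2 * A - (1 - (x i)\<^sup>2) * B"
    by (simp only: dvd_add dvd_mult dvd_triv_left)
  then show ?case
    using insert.hyps by (simp add: A_def B_def power_mult_distrib)
qed simp

lemma euler_fps_square_mod_2:
  assumes "k > 0"
  shows "2 dvd (euler_fps k)\<^sup>2 - euler_fps (2 * k)"
  unfolding two_dvd_fps_iff
proof
  fix n
  define P :: "int fps" where "P = (\<Prod>i\<in>{0<..n}. 1 - (fps_X ^ k) ^ i)"
  define Q :: "int fps" where "Q = (\<Prod>i\<in>{0<..n}. 1 - (fps_X ^ (2 * k)) ^ i)"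
  have "Q = (\<Prod>i\<in>{0<..n}. 1 - ((fps_X ^ k) ^ i)\<^sup>2)"
    unfolding Q_def by (simp add: mult_ac flip: power_mult)
  then have "2 dvd P\<^sup>2 - Q"
    using prod_square_mod_2[of "{0<..n}" "\<lambda>i. (fps_X ^ k) ^ i :: int fps"] by (simp add: P_def)
  then have "even (fps_nth (P\<^sup>2 - Q) n)"
    by (simp only: two_dvd_fps_iff)
  moreover have "fps_nth (euler_fps (2 * k)) n = fps_nth Q n"
    unfolding Q_def using assms by (intro euler_fps_nth) auto
  moreover have "fps_nth (euler_fps k) i = fps_nth P i" if "i \<le> n" for i
    unfolding P_def using assms that by (rule euler_fps_nth)
  then have "fps_nth ((euler_fps k)\<^sup>2) n = fps_nth (P\<^sup>2) n"
    by (simp add: power2_eq_square fps_mult_nth)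
  ultimately show "even (fps_nth ((euler_fps k)\<^sup>2 - euler_fps (2 * k)) n)"
    by simp
qed

text \<open>
  Modulo \<open>2\<close> the defining relation reads \<open>B * f\<^sub>4 \<equiv> f\<^sub>4^3\<close> for the generating function \<open>B\<close> of \<open>b\<close>,
  and \<open>f\<^sub>4\<close> can be cancelled because its constant term is \<open>1\<close>.
\<close>

lemma b_gen_fun_mod_2: "2 dvd Abs_fps b - euler_fps 8"
proof -
  define B where "B = Abs_fps b"
  define G where "G = fps_right_inverse (euler_fps 4) 1"
  have G: "euler_fps 4 * G = 1"
    unfolding G_def by (rule fps_right_inverse) (simp add: fps_nth_0_euler_fps)
  have "B * (euler_fps 2)\<^sup>2 = euler_fps 4 ^ 3"
    unfolding B_def by (rule b_gen_fun)
  then have "euler_fps 4 * (B - (euler_fps 4)\<^sup>2) = - B * ((euler_fps 2)\<^sup>2 - euler_fps 4)"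
    by (simp add: algebra_simps power2_eq_square power3_eq_cube)
  moreover have "2 dvd (euler_fps 2)\<^sup>2 - euler_fps 4"
    using euler_fps_square_mod_2[of 2] by simp
  ultimately have "2 dvd G * (euler_fps 4 * (B - (euler_fps 4)\<^sup>2))"
    by (simp only: dvd_mult)
  also have "G * (euler_fps 4 * (B - (euler_fps 4)\<^sup>2)) = (euler_fps 4 * G) * (B - (euler_fps 4)\<^sup>2)"
    by (simp only: mult_ac)
  finally have "2 dvd B - (euler_fps 4)\<^sup>2"
    by (simp add: G)
  moreover have "2 dvd (euler_fps 4)\<^sup>2 - euler_fps 8"
    using euler_fps_square_mod_2[of 4] by simp
  ultimately have "2 dvd (B - (euler_fps 4)\<^sup>2) + ((euler_fps 4)\<^sup>2 - euler_fps 8)"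
    by (rule dvd_add)
  then show ?thesis by (simp add: B_def)
qed

lemma odd_b_imp_square:
  assumes "odd (b m)"
  shows "\<exists>r. 3 * m + 1 = r\<^sup>2"
proof -
  have "even (b m - fps_nth (euler_fps 8) m)"
    using b_gen_fun_mod_2 unfolding two_dvd_fps_iff by simp
  then have "fps_nth (euler_fps 8) m \<noteq> 0"
    using assms by auto
  then obtain r where "24 * m + 8 = 8 * r\<^sup>2"
    using euler_fps_support[of 8 m] by auto
  then have "3 * m + 1 = r\<^sup>2" by simp
  then show ?thesis by blast
qed

section \<open>The congruence\<close>

lemma odd_prime_power_mult_not_square:
  fixes p c r :: nat
  assumes "prime p" and "odd e" and "\<not> p dvd c"
  shows "p ^ e * c \<noteq> r\<^sup>2"
proof
  assume eq: "p ^ e * c = r\<^sup>2"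
  have "c \<noteq> 0" using assms(3) by (metis dvd_0_right)
  then have "r \<noteq> 0" using eq assms(1) by (metis mult_eq_0_iff not_prime_0 power_eq_0_iff zero_power2)
  have "multiplicity p (p ^ e * c) = e"
    using assms by (intro multiplicity_eqI) auto
  moreover have "multiplicity p (r\<^sup>2) = 2 * multiplicity p r"
    using \<open>r \<noteq> 0\<close> assms(1) by (simp add: prime_elem_multiplicity_power_distrib)
  ultimately show False
    using eq assms(2) by (metis dvd_triv_left)
qed

theorem theorem3p1:
  fixes n \<alpha> p j :: nat
  assumes "\<alpha> \<ge> 1"
    and "prime p" and "p \<ge> 5"
    and "j \<in> {1..p - 1}"
  shows "[b (p ^ (2 * \<alpha>) * n + ((3 * j + p) * p ^ (2 * \<alpha> - 1) - 1) div 3) = 0] (mod 2)"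
proof -
  define m where "m = p ^ (2 * \<alpha>) * n + ((3 * j + p) * p ^ (2 * \<alpha> - 1) - 1) div 3"
  define c where "c = 3 * j + p * (3 * n + 1)"
  have "p ^ (2 * \<alpha>) = p ^ (2 * \<alpha> - 1) * p"
    using assms(1) by (simp add: power_eq_if)
  then have m: "3 * m + 1 = p ^ (2 * \<alpha> - 1) * c"
    using index_exact[OF assms(2,3,1), of j]
    unfolding m_def c_def by (simp add: algebra_simps)
  have "\<not> p dvd 3"
    using assms(3) by (auto dest: dvd_imp_le)
  moreover have "\<not> p dvd j"
    using assms(3,4) by (auto dest: dvd_imp_le)
  ultimately have "\<not> p dvd 3 * j"
    using assms(2) by (simp add: prime_dvd_mult_iff)
  then have "\<not> p dvd c"
    unfolding c_def by (simp add: dvd_add_left_iff)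
  then have "3 * m + 1 \<noteq> r\<^sup>2" for r
    unfolding m using assms(1,2) by (intro odd_prime_power_mult_not_square) auto
  then have "even (b m)"
    using odd_b_imp_square by blast
  then show ?thesis
    by (simp add: m_def cong_0_iff)
qed

end
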